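(* Let $n\ge 1$ and let $P_n$ be a labeled path on $n$ vertices. Then the chromatic quasisymmetric function $X(P_n;\mathbf{x},q)$ is symmetric if and only if $P_n$ has the natural labeling.
   Context: A labeled graph is a finite simple graph $G=(V,E)$ with vertex set $V=[n]=\{1,\dots,n\}$. A proper coloring is a map $c\colon[n]\to\mathbb{P}=\{1,2,\dots\}$ with $c(i)\neq c(j)$ whenever $ij\in E$. Its ascent set is $\operatorname{Asc}(c)=\{ij\in E : i<j,\ c(i)<c(j)\}$ and $\operatorname{asc}(c)=\#\operatorname{Asc}(c)$. The chromatic quasisymmetric function (CQF) is $X(G;\mathbf{x},q)=\sum_{c}x_{c(1)}x_{c(2)}\cdots x_{c(n)}\,q^{\operatorname{asc}(c)}$, summed over proper colorings $c$; it is a polynomial in $q$ whose coefficients are quasisymmetric functions. It is called symmetric if every coefficient of $q^k$ is a symmetric function. A labeled path $P_n$ is the path graph with vertices $v_1,\dots,v_n$ (edges $v_iv_{i+1}$, $1\le i\le n-1$) where $v_i$ carries label $\sigma_i$ for a permutation $\sigma=\sigma_1\cdots\sigma_n$ of $[n]$ (vertices are identified with their labels). The natural labeling is $\sigma=12\cdots n$ or $\sigma=n\cdots 21$. *)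

theory Defs
  imports "HOL-Combinatorics.Permutations"
begin

text \<open>A labeled graph on vertex set [n] = {1..n} is given by a symmetric,
irreflexive edge relation E on nat (only vertices in {1..n} matter).
Colours are positive integers; a colouring is a function nat => nat that is
positive on [n] and 0 outside [n] (so that colourings of [n] are represented
uniquely).\<close>

definition proper_colorings :: "nat \<Rightarrow> (nat \<Rightarrow> nat \<Rightarrow> bool) \<Rightarrow> (nat \<Rightarrow> nat) set" where
  "proper_colorings n E =
     {c. (\<forall>i\<in>{1..n}. 1 \<le> c i) \<and> (\<forall>i. i \<notin> {1..n} \<longrightarrow> c i = 0)
         \<and> (\<forall>i\<in>{1..n}. \<forall>j\<in>{1..n}. E i j \<longrightarrow> c i \<noteq> c j)}"

definition asc :: "nat \<Rightarrow> (nat \<Rightarrow> nat \<Rightarrow> bool) \<Rightarrow> (nat \<Rightarrow> nat) \<Rightarrow> nat" where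
  "asc n E c = card {(i,j). i \<in> {1..n} \<and> j \<in> {1..n} \<and> E i j \<and> i < j \<and> c i < c j}"

text \<open>Coefficient of the monomial x^alpha q^k in X(G;x,q), where
alpha : nat => nat is an exponent vector (alpha m = exponent of x_m).
x_{c(1)} ... x_{c(n)} equals x^alpha iff alpha m = #{i in [n]. c i = m} for all m.\<close>
definition cqf_coeff :: "nat \<Rightarrow> (nat \<Rightarrow> nat \<Rightarrow> bool) \<Rightarrow> (nat \<Rightarrow> nat) \<Rightarrow> nat \<Rightarrow> nat" where
  "cqf_coeff n E alpha k =
     card {c \<in> proper_colorings n E.
             (\<forall>m. card {i\<in>{1..n}. c i = m} = alpha m) \<and> asc n E c = k}"

text \<open>X(G;x,q) is symmetric iff every coefficient of q^k is a symmetric function,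
i.e. invariant under every permutation pi of the variable index set P = {1,2,...}:
the coefficient of x^alpha equals that of x^(alpha o pi).\<close>
definition cqf_symmetric :: "nat \<Rightarrow> (nat \<Rightarrow> nat \<Rightarrow> bool) \<Rightarrow> bool" where
  "cqf_symmetric n E \<longleftrightarrow>
     (\<forall>k pi alpha. pi permutes {1..} \<longrightarrow>
        cqf_coeff n E (alpha \<circ> pi) k = cqf_coeff n E alpha k)"

text \<open>Labeled path: vertices v_1..v_n with v_i labeled sigma i, edges v_i v_(i+1).\<close>
definition path_edges :: "nat \<Rightarrow> (nat \<Rightarrow> nat) \<Rightarrow> nat \<Rightarrow> nat \<Rightarrow> bool" where
  "path_edges n sigma a b \<longleftrightarrow>
     (\<exists>i\<in>{1..<n}. (a = sigma i \<and> b = sigma (Suc i)) \<or> (a = sigma (Suc i) \<and> b = sigma i))"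

definition natural_labeling :: "nat \<Rightarrow> (nat \<Rightarrow> nat) \<Rightarrow> bool" where
  "natural_labeling n sigma \<longleftrightarrow>
     (\<forall>i\<in>{1..n}. sigma i = i) \<or> (\<forall>i\<in>{1..n}. sigma i = n + 1 - i)"

end

theory Submission
  imports Defs
begin

text \<open>Reading colours along the path turns colourings into words with distinct neighbours, and the
  exponent of q counts the steps whose direction agrees with that of the labeling.

  For the natural labeling this is the number of ascents. Swapping two adjacent colours z and z + 1
  in every maximal block over these colours of odd length is an involution that preserves the
  ascents and exchanges the two multiplicities, so the function is symmetric.

  Conversely, only the top power q^(n-1) is needed. It enumerates the aligned words, whose steps all
  go the way of the labeling. In an aligned word the smallest colour occurs only at local minima of
  the labeling and the largest only at local maxima. Under symmetry every colour class of every
  aligned word is therefore at most as large as the set of minima and as the set of maxima. Suitable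
  words give that there are as many minima as maxima, hence that the first and the last step go the
  same way, say up, and then that no two consecutive steps go down. In that case let a be the number
  of ascending runs. If the words that are merely increasing on the runs are counted by content, the
  count is symmetric (Bender-Knuth), and for contents with a letters 1 all these words are
  aligned. But if there is a descent, some content having a equal letters admits a word that is
  increasing on the runs and not aligned.\<close>

subsection \<open>Colourings of a path as words\<close>

definition words :: "nat \<Rightarrow> (nat \<Rightarrow> nat) set" where
  "words n = {w. (\<forall>i\<in>{1..n}. 1 \<le> w i) \<and> (\<forall>i. i \<notin> {1..n} \<longrightarrow> w i = 0)}"

definition content :: "nat \<Rightarrow> (nat \<Rightarrow> nat) \<Rightarrow> nat \<Rightarrow> nat" where
  "content n w m = card {i\<in>{1..n}. w i = m}"

definition proper_words :: "nat \<Rightarrow> (nat \<Rightarrow> nat) set" where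
  "proper_words n = {w \<in> words n. \<forall>i\<in>{1..<n}. w i \<noteq> w (Suc i)}"

lemma content_comp_permutes:
  assumes "sigma permutes {1..n}"
  shows "content n (c \<circ> sigma) = content n c"
proof
  fix m
  have "bij_betw sigma {i\<in>{1..n}. c (sigma i) = m} {i\<in>{1..n}. c i = m}"
  proof (rule bij_betw_byWitness[where f' = "inv sigma"])
    show "\<forall>a\<in>{i \<in> {1..n}. c (sigma i) = m}. inv sigma (sigma a) = a"
      using permutes_inverses(2)[OF assms] by auto
    show "\<forall>a'\<in>{i \<in> {1..n}. c i = m}. sigma (inv sigma a') = a'"
      using permutes_inverses(1)[OF assms] by auto
    show "sigma ` {i \<in> {1..n}. c (sigma i) = m} \<subseteq> {i \<in> {1..n}. c i = m}"
      using permutes_in_image[OF assms] by auto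
    show "inv sigma ` {i \<in> {1..n}. c i = m} \<subseteq> {i \<in> {1..n}. c (sigma i) = m}"
      using permutes_in_image[OF permutes_inv[OF assms]] permutes_inverses(1)[OF assms] by auto
  qed
  then show "content n (c \<circ> sigma) m = content n c m"
    unfolding content_def by (simp add: bij_betw_same_card)
qed

lemma words_comp_permutes:
  assumes "sigma permutes {1..n}" "c \<in> words n"
  shows "c \<circ> sigma \<in> words n"
  using assms permutes_in_image[OF assms(1)] unfolding words_def by auto

lemma proper_colorings_path_iff:
  assumes "sigma permutes {1..n}"
  shows "c \<in> proper_colorings n (path_edges n sigma) \<longleftrightarrow> c \<in> words n \<and> c \<circ> sigma \<in> proper_words n"
proof
  assume c: "c \<in> proper_colorings n (path_edges n sigma)"
  then have w: "c \<in> words n"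
    unfolding proper_colorings_def words_def by auto
  have "c (sigma i) \<noteq> c (sigma (Suc i))" if i: "i \<in> {1..<n}" for i
  proof -
    have "path_edges n sigma (sigma i) (sigma (Suc i))"
      using i unfolding path_edges_def by auto
    moreover have "sigma i \<in> {1..n}" "sigma (Suc i) \<in> {1..n}"
      using i permutes_in_image[OF assms] by simp_all
    ultimately show ?thesis using c unfolding proper_colorings_def by blast
  qed
  then show "c \<in> words n \<and> c \<circ> sigma \<in> proper_words n"
    using w words_comp_permutes[OF assms w] unfolding proper_words_def by simp
next
  assume "c \<in> words n \<and> c \<circ> sigma \<in> proper_words n"
  then show "c \<in> proper_colorings n (path_edges n sigma)"
    unfolding proper_colorings_def words_def proper_words_def path_edges_def by fastforce
qed

text \<open>Step \<open>i\<close> of the path is sent to its edge with the smaller label first. The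
  colour rises along that edge exactly if labels and colours move in the same direction at step
  \<open>i\<close>. Properness matters here: with equal colours and falling labels the equivalence
  on the right would hold although there is no ascent.\<close>

lemma asc_path:
  assumes sigma: "sigma permutes {1..n}" and w: "c \<circ> sigma \<in> proper_words n"
  shows "asc n (path_edges n sigma) c =
    card {i\<in>{1..<n}. sigma i < sigma (Suc i) \<longleftrightarrow> (c \<circ> sigma) i < (c \<circ> sigma) (Suc i)}"
    (is "_ = card ?I")
proof -
  let ?f = "\<lambda>i. if sigma i < sigma (Suc i) then (sigma i, sigma (Suc i)) else (sigma (Suc i), sigma i)"
  have inj: "inj sigma" using permutes_inj[OF sigma] .
  have ne: "c (sigma i) \<noteq> c (sigma (Suc i))" if "i \<in> {1..<n}" for i
    using w that unfolding proper_words_def by simp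
  have sne: "sigma i \<noteq> sigma (Suc i)" for i
    using injD[OF inj, of i "Suc i"] by auto
  have "inj_on ?f ?I"
    by (rule inj_onI) (auto split: if_splits dest!: injD[OF inj])
  moreover have "?f ` ?I = {(i,j). i \<in> {1..n} \<and> j \<in> {1..n} \<and> path_edges n sigma i j \<and> i < j \<and> c i < c j}"
    (is "_ = ?R")
  proof
    show "?f ` ?I \<subseteq> ?R"
    proof
      fix p assume "p \<in> ?f ` ?I"
      then obtain i where i: "i \<in> ?I" "p = ?f i" by blast
      have "sigma i \<in> {1..n}" "sigma (Suc i) \<in> {1..n}"
        using i permutes_in_image[OF sigma] by simp_all
      moreover have "path_edges n sigma (sigma i) (sigma (Suc i))" "path_edges n sigma (sigma (Suc i)) (sigma i)"
        using i unfolding path_edges_def by auto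
      ultimately show "p \<in> ?R" using i ne[of i] sne[of i] by auto
    qed
    show "?R \<subseteq> ?f ` ?I"
    proof
      fix p assume "p \<in> ?R"
      then obtain a b where p: "p = (a,b)" "path_edges n sigma a b" "a < b" "c a < c b" by auto
      then obtain i where "i\<in>{1..<n}" "(a = sigma i \<and> b = sigma (Suc i)) \<or> (a = sigma (Suc i) \<and> b = sigma i)"
        unfolding path_edges_def by blast
      then have "i \<in> ?I" "p = ?f i" using p by auto
      then show "p \<in> ?f ` ?I" by blast
    qed
  qed
  ultimately show ?thesis
    unfolding asc_def by (metis (no_types, lifting) card_image)
qed

lemma cqf_coeff_path:
  assumes "sigma permutes {1..n}"
  shows "cqf_coeff n (path_edges n sigma) alpha k =
    card {w \<in> proper_words n. content n w = alpha \<and>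
      card {i\<in>{1..<n}. sigma i < sigma (Suc i) \<longleftrightarrow> w i < w (Suc i)} = k}"
    (is "_ = card ?W")
proof -
  have inv: "sigma \<circ> inv sigma = id" "inv sigma \<circ> sigma = id"
    using permutes_inv_o[OF assms] by simp_all
  have pw: "w \<in> words n" if "w \<in> proper_words n" for w
    using that unfolding proper_words_def by simp
  have eq: "{c \<in> proper_colorings n (path_edges n sigma).
      (\<forall>m. card {i\<in>{1..n}. c i = m} = alpha m) \<and> asc n (path_edges n sigma) c = k}
      = {c \<in> words n. c \<circ> sigma \<in> ?W}" (is "?C = ?D")
  proof -
    have "(\<forall>m. card {i\<in>{1..n}. c i = m} = alpha m) \<longleftrightarrow> content n (c \<circ> sigma) = alpha" for c
      unfolding content_comp_permutes[OF assms] content_def fun_eq_iff ..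
    then show ?thesis
      using proper_colorings_path_iff[OF assms] asc_path[OF assms] by auto
  qed
  have "bij_betw (\<lambda>c. c \<circ> sigma) ?D ?W"
  proof (rule bij_betw_byWitness[where f' = "\<lambda>w. w \<circ> inv sigma"])
    show "\<forall>a\<in>?D. (a \<circ> sigma) \<circ> inv sigma = a" using inv by (simp add: comp_assoc)
    show "\<forall>a'\<in>?W. (a' \<circ> inv sigma) \<circ> sigma = a'" using inv by (simp add: comp_assoc)
    show "(\<lambda>c. c \<circ> sigma) ` ?D \<subseteq> ?W" by blast
    show "(\<lambda>w. w \<circ> inv sigma) ` ?W \<subseteq> ?D"
    proof
      fix c assume "c \<in> (\<lambda>w. w \<circ> inv sigma) ` ?W"
      then obtain w where w: "w \<in> ?W" "c = w \<circ> inv sigma" by blast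
      then have "c \<circ> sigma = w" using inv by (simp add: comp_assoc)
      moreover have "c \<in> words n" using w words_comp_permutes[OF permutes_inv[OF assms]] pw by blast
      ultimately show "c \<in> ?D" using w(1) by (metis (mono_tags, lifting) mem_Collect_eq)
    qed
  qed
  then show ?thesis unfolding cqf_coeff_def eq by (rule bij_betw_same_card)
qed

definition aligned_words :: "nat \<Rightarrow> (nat \<Rightarrow> bool) \<Rightarrow> (nat \<Rightarrow> nat) set" where
  "aligned_words n up = {w \<in> words n. \<forall>i\<in>{1..<n}. if up i then w i < w (Suc i) else w (Suc i) < w i}"

text \<open>A path has only \<open>n - 1\<close> steps, so the top power of q forces every one of
  them to agree with the labeling.\<close>

lemma cqf_coeff_path_top:
  assumes "sigma permutes {1..n}"
  shows "cqf_coeff n (path_edges n sigma) alpha (n - 1) =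
    card {w \<in> aligned_words n (\<lambda>i. sigma i < sigma (Suc i)). content n w = alpha}"
proof -
  have "card {i\<in>{1..<n}. P i} = n - 1 \<longleftrightarrow> (\<forall>i\<in>{1..<n}. P i)" for P
  proof
    assume "card {i\<in>{1..<n}. P i} = n - 1"
    then have "{i\<in>{1..<n}. P i} = {1..<n}" by (intro card_subset_eq) auto
    then show "\<forall>i\<in>{1..<n}. P i" by blast
  next
    assume "\<forall>i\<in>{1..<n}. P i"
    then have "{i\<in>{1..<n}. P i} = {1..<n}" by blast
    then show "card {i\<in>{1..<n}. P i} = n - 1" by simp
  qed
  note all = this
  have "{w \<in> proper_words n. content n w = alpha \<and>
      card {i\<in>{1..<n}. sigma i < sigma (Suc i) \<longleftrightarrow> w i < w (Suc i)} = n - 1}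
    = {w \<in> aligned_words n (\<lambda>i. sigma i < sigma (Suc i)). content n w = alpha}"
    unfolding all proper_words_def aligned_words_def by (auto simp: not_less_iff_gr_or_eq)
  then show ?thesis unfolding cqf_coeff_path[OF assms] by simp
qed

text \<open>Makes the cardinalities below meaningful: the content fixes which colours occur, so all
  words of one content take values in a common finite set.\<close>

lemma finite_words_content: "finite {w \<in> words n. content n w = alpha}"
proof (cases "\<exists>w \<in> words n. content n w = alpha")
  case True
  then obtain w where w: "w \<in> words n" "content n w = alpha" by blast
  let ?C = "insert 0 (w ` {1..n})"
  have "{w \<in> words n. content n w = alpha} \<subseteq> {v. \<forall>i. (i \<in> {1..n} \<longrightarrow> v i \<in> ?C) \<and> (i \<notin> {1..n} \<longrightarrow> v i = 0)}"
  proof safe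
    fix v i assume v: "v \<in> words n" "alpha = content n v" and i: "i \<in> {1..n}" "v i \<notin> w ` {1..n}"
    have "content n v (v i) \<noteq> 0" using i unfolding content_def by auto
    moreover have "content n w (v i) = 0" using i unfolding content_def by (force simp: image_iff)
    ultimately have False using v w by simp
    then show "v i = 0" ..
  next
    fix v i assume "v \<in> words n" "i \<notin> {1..n}"
    then show "v i = 0" unfolding words_def by blast
  qed
  moreover have "finite {v. \<forall>i. (i \<in> {1..n} \<longrightarrow> v i \<in> ?C) \<and> (i \<notin> {1..n} \<longrightarrow> v i = 0)}"
    by (rule finite_set_of_finite_funs) auto
  ultimately show ?thesis by (rule finite_subset)
next
  case False
  then show ?thesis by (metis (mono_tags, lifting) empty_Collect_eq finite.emptyI)
qed

subsection \<open>Reduction to adjacent transpositions\<close>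

lemma transpose_invariant_if_adjacent:
  fixes G :: "(nat \<Rightarrow> nat) \<Rightarrow> nat"
  assumes adj: "\<And>z alpha. 1 \<le> z \<Longrightarrow> G (alpha \<circ> transpose z (Suc z)) = G alpha"
    and a: "1 \<le> a" and ab: "a \<le> b"
  shows "G (alpha \<circ> transpose a b) = G alpha"
  using ab
proof (induction b arbitrary: alpha rule: dec_induct)
  case base
  then show ?case by simp
next
  case (step b)
  show ?case
  proof (cases "a = b")
    case True
    show ?thesis unfolding True[symmetric] by (rule adj[OF a])
  next
    case False
    \<comment> \<open>Conjugation by an adjacent transposition moves the far end from
      \<open>b\<close> to \<open>Suc b\<close>. The induction hypothesis is then used at a modified
      exponent vector, hence the generalisation over \<open>alpha\<close>.\<close>
    have "transpose a (Suc b) = transpose b (Suc b) \<circ> (transpose a b \<circ> transpose b (Suc b))"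
      using step.hyps False by (auto simp: fun_eq_iff transpose_def)
    then have "G (alpha \<circ> transpose a (Suc b))
        = G (((alpha \<circ> transpose b (Suc b)) \<circ> transpose a b) \<circ> transpose b (Suc b))"
      by (simp only: comp_assoc)
    also have "\<dots> = G ((alpha \<circ> transpose b (Suc b)) \<circ> transpose a b)"
      by (rule adj) (use step.hyps a in simp)
    also have "\<dots> = G (alpha \<circ> transpose b (Suc b))" by (rule step.IH)
    also have "\<dots> = G alpha" by (rule adj) (use step.hyps a in simp)
    finally show ?thesis .
  qed
qed

lemma permutes_finite_invariant_if_adjacent:
  fixes G :: "(nat \<Rightarrow> nat) \<Rightarrow> nat"
  assumes adj: "\<And>z alpha. 1 \<le> z \<Longrightarrow> G (alpha \<circ> transpose z (Suc z)) = G alpha"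
    and p: "p permutes {1..N}"
  shows "G (alpha \<circ> p) = G alpha"
proof -
  have "\<forall>alpha. G (alpha \<circ> p) = G alpha"
    using p finite_atLeastAtMost
  proof (induction rule: permutes_induct)
    case id
    then show ?case by simp
  next
    case (swap a b p)
    have "G (alpha \<circ> transpose a b) = G alpha" for alpha
    proof (cases "a \<le> b")
      case True
      show ?thesis
        by (rule transpose_invariant_if_adjacent[of G, OF adj _ True]) (use swap.hyps in auto)
    next
      case False
      then have ba: "b \<le> a" by simp
      have "G (alpha \<circ> transpose b a) = G alpha"
        by (rule transpose_invariant_if_adjacent[of G, OF adj _ ba]) (use swap.hyps in auto)
      then show ?thesis by (simp add: transpose_commute)
    qed
    then show ?case using swap.IH by (simp only: comp_assoc[symmetric]) simp
  qed
  then show ?thesis by blast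
qed

text \<open>Symmetry allows permutations that move infinitely many variables. On a finitely
  supported exponent vector only the finite set of indices sent into the support counts; there
  \<open>p\<close> is kept, and it is completed to a permutation of an initial segment by any
  bijection of the equally large complements.\<close>

lemma finite_permutation_agreeing_on_support:
  fixes alpha :: "nat \<Rightarrow> nat"
  assumes p: "p permutes {1..}" and fin: "finite {m. alpha m \<noteq> 0}"
  shows "\<exists>N q. q permutes {1..N} \<and> alpha \<circ> q = alpha \<circ> p"
proof -
  \<comment> \<open>Index 0 is left out: \<open>alpha 0\<close> is arbitrary, but \<open>p\<close>
    and the new permutation both fix 0.\<close>
  define D where "D = {m\<in>{1..}. alpha (p m) \<noteq> 0}"
  have bij: "bij p" using p by (rule permutes_bij)
  have pin: "p m \<in> {1..} \<longleftrightarrow> m \<in> {1..}" for m using permutes_in_image[OF p] .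
  have "p ` D \<subseteq> {m. alpha m \<noteq> 0}" unfolding D_def by auto
  then have "finite (p ` D)" using fin finite_subset by blast
  moreover have injD: "inj_on p D" using permutes_inj_on[OF p] .
  ultimately have finD: "finite D" "finite (p ` D)" by (auto simp: finite_image_iff)
  then have "finite (D \<union> p ` D)" by simp
  then obtain N where N: "\<forall>x\<in>D \<union> p ` D. x \<le> N" using finite_nat_set_iff_bounded_le by blast
  have D: "D \<subseteq> {1..N}" "p ` D \<subseteq> {1..N}"
    using N pin unfolding D_def by auto
  have "card ({1..N} - D) = card ({1..N} - p ` D)"
    using D finD card_image[OF injD] by (simp add: card_Diff_subset)
  then obtain g where g: "bij_betw g ({1..N} - D) ({1..N} - p ` D)"
    using finite_same_card_bij[of "{1..N} - D" "{1..N} - p ` D"] by auto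
  define q where "q m = (if m \<in> D then p m else if m \<in> {1..N} then g m else m)" for m
  have "bij_betw q D (p ` D)"
    using injD by (auto simp: q_def bij_betw_def inj_on_def)
  moreover have "bij_betw q ({1..N} - D) ({1..N} - p ` D)"
    using g by (rule bij_betw_cong[THEN iffD1, rotated]) (auto simp: q_def)
  ultimately have "bij_betw q (D \<union> ({1..N} - D)) (p ` D \<union> ({1..N} - p ` D))"
    by (rule bij_betw_combine) blast
  moreover have "D \<union> ({1..N} - D) = {1..N}" "p ` D \<union> ({1..N} - p ` D) = {1..N}"
    using D by blast+
  ultimately have bijq: "bij_betw q {1..N} {1..N}" by metis
  have perm: "q permutes {1..N}"
    using bijq D by (intro bij_imp_permutes) (auto simp: q_def)
  have off: "alpha m = 0" if "m \<notin> p ` D" "1 \<le> m" for m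
  proof (rule ccontr)
    assume "alpha m \<noteq> 0"
    moreover obtain m' where m': "m = p m'" using bij by (metis bij_pointE)
    moreover have "m' \<in> {1..}" using pin[of m'] that m' by simp
    ultimately have "m' \<in> D" unfolding D_def by simp
    then show False using that m' by blast
  qed
  have "alpha (q m) = alpha (p m)" for m
  proof (cases "m \<in> D \<or> m = 0")
    case True
    have "p 0 = 0" using permutes_not_in[OF p] by simp
    then show ?thesis using True D unfolding q_def by auto
  next
    case False
    then have z: "alpha (p m) = 0" unfolding D_def by simp
    show ?thesis
    proof (cases "m \<in> {1..N}")
      case True
      then have "g m \<in> {1..N} - p ` D" using g False unfolding bij_betw_def by blast
      then show ?thesis using True False z off[of "g m"] unfolding q_def by simp
    next
      case out: False
      then have "m \<notin> p ` D" using D(2) by blast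
      then have "alpha m = 0" using False by (intro off) auto
      then show ?thesis using z out False unfolding q_def by simp
    qed
  qed
  then have "alpha \<circ> q = alpha \<circ> p" by (simp add: fun_eq_iff)
  then show ?thesis using perm by blast
qed

text \<open>Finitely many vertices use finitely many colours. This settles the exponent vectors not
  reached by finite permutations.\<close>

lemma cqf_coeff_infinite_support:
  assumes "infinite {m. alpha m \<noteq> 0}"
  shows "cqf_coeff n E alpha k = 0"
proof -
  have "\<not> (\<forall>m. card {i\<in>{1..n}. c i = m} = alpha m)" for c
  proof
    assume *: "\<forall>m. card {i\<in>{1..n}. c i = m} = alpha m"
    have "{m. alpha m \<noteq> 0} \<subseteq> c ` {1..n}"
    proof
      fix m assume "m \<in> {m. alpha m \<noteq> 0}"
      then have "{i\<in>{1..n}. c i = m} \<noteq> {}" using * by (auto simp: card_eq_0_iff simp flip: *[rule_format])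
      then show "m \<in> c ` {1..n}" by blast
    qed
    then show False using assms finite_subset by blast
  qed
  then have "{c \<in> proper_colorings n E.
      (\<forall>m. card {i\<in>{1..n}. c i = m} = alpha m) \<and> asc n E c = k} = {}"
    by blast
  then show ?thesis unfolding cqf_coeff_def by (simp only: card.empty)
qed

lemma cqf_symmetric_if_adjacent:
  assumes adj: "\<And>z alpha k. 1 \<le> z \<Longrightarrow>
    cqf_coeff n E (alpha \<circ> transpose z (Suc z)) k = cqf_coeff n E alpha k"
  shows "cqf_symmetric n E"
  unfolding cqf_symmetric_def
proof (intro allI impI)
  fix k p and alpha :: "nat \<Rightarrow> nat" assume p: "p permutes {1::nat..}"
  show "cqf_coeff n E (alpha \<circ> p) k = cqf_coeff n E alpha k"
  proof (cases "finite {m. alpha m \<noteq> 0}")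
    case True
    then obtain N q where "q permutes {1..N}" "alpha \<circ> q = alpha \<circ> p"
      using finite_permutation_agreeing_on_support[OF p] by blast
    then show ?thesis
      using permutes_finite_invariant_if_adjacent[of "\<lambda>a. cqf_coeff n E a k" q N alpha] adj by simp
  next
    case False
    have "{m. alpha m \<noteq> 0} \<subseteq> p ` {m. (alpha \<circ> p) m \<noteq> 0}"
    proof
      fix m assume "m \<in> {m. alpha m \<noteq> 0}"
      moreover obtain m' where "m = p m'" using permutes_surj[OF p] by (rule surjE)
      ultimately show "m \<in> p ` {m. (alpha \<circ> p) m \<noteq> 0}" by auto
    qed
    then have "infinite {m. (alpha \<circ> p) m \<noteq> 0}"
      using False finite_subset by blast
    then show ?thesis using False by (simp add: cqf_coeff_infinite_support)
  qed
qed

subsection \<open>Symmetry for the natural labeling\<close>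

fun ascents :: "nat list \<Rightarrow> nat" where
  "ascents (x # y # ys) = (if x < y then 1 else 0) + ascents (y # ys)"
| "ascents xs = 0"

text \<open>In a word with distinct neighbours a block over \<open>z\<close> and
  \<open>Suc z\<close> alternates. If its length is odd, it has as many ascents as descents, so the
  exchange preserves ascents. If its length is even, both colours are already equally frequent, and
  an exchange in a nonempty block would change the number of ascents.\<close>

definition swap_odd :: "nat \<Rightarrow> nat list \<Rightarrow> nat list" where
  "swap_odd z r = (if odd (length r) then map (transpose z (Suc z)) r else r)"

function flip_blocks :: "nat \<Rightarrow> nat list \<Rightarrow> nat list" where
  "flip_blocks z xs = (case dropWhile (\<lambda>x. x \<in> {z, Suc z}) xs of
      [] \<Rightarrow> swap_odd z xs
    | x # t \<Rightarrow> swap_odd z (takeWhile (\<lambda>x. x \<in> {z, Suc z}) xs) @ x # flip_blocks z t)"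
  by auto
termination
proof (relation "measure (length \<circ> snd)")
  fix z xs x and t :: "nat list"
  assume "dropWhile (\<lambda>x. x \<in> {z, Suc z}) xs = x # t"
  then show "((z, t), z, xs) \<in> measure (length \<circ> snd)"
    using length_dropWhile_le[of "\<lambda>x. x \<in> {z, Suc z}" xs] by simp
qed simp

declare flip_blocks.simps [simp del]

lemma flip_blocks_block:
  assumes "set r \<subseteq> {z, Suc z}"
  shows "flip_blocks z r = swap_odd z r"
proof -
  have "dropWhile (\<lambda>x. x \<in> {z, Suc z}) r = []"
    using assms unfolding dropWhile_eq_Nil_conv by blast
  then show ?thesis by (simp only: flip_blocks.simps[of z r] list.case)
qed

lemma flip_blocks_step:
  assumes "set r \<subseteq> {z, Suc z}" "x \<notin> {z, Suc z}"
  shows "flip_blocks z (r @ x # t) = swap_odd z r @ x # flip_blocks z t"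
proof -
  have "dropWhile (\<lambda>x. x \<in> {z, Suc z}) (r @ x # t) = x # t"
    "takeWhile (\<lambda>x. x \<in> {z, Suc z}) (r @ x # t) = r"
    using assms by (auto simp: dropWhile_append takeWhile_append)
  then show ?thesis by (simp only: flip_blocks.simps[of z "r @ x # t"] list.case)
qed

text \<open>Follows the recursion of \<open>flip_blocks\<close>: either all letters lie in
  \<open>A\<close>, or the list is cut at its first letter outside \<open>A\<close>.\<close>

lemma block_induct [case_names block step]:
  assumes "\<And>r. set r \<subseteq> A \<Longrightarrow> Q r"
    and "\<And>r x t. set r \<subseteq> A \<Longrightarrow> x \<notin> A \<Longrightarrow> Q t \<Longrightarrow> Q (r @ x # t)"
  shows "Q xs"
proof (induction xs rule: length_induct)
  case (1 xs)
  show ?case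
  proof (cases "dropWhile (\<lambda>x. x \<in> A) xs")
    case Nil
    then have "set xs \<subseteq> A" unfolding dropWhile_eq_Nil_conv by blast
    then show ?thesis by (rule assms(1))
  next
    case (Cons x t)
    then have xs: "xs = takeWhile (\<lambda>x. x \<in> A) xs @ x # t"
      by (metis takeWhile_dropWhile_id)
    have "length xs = length (takeWhile (\<lambda>x. x \<in> A) xs @ x # t)"
      using xs by (rule arg_cong)
    then have "Q t" using 1 by simp
    moreover have "x \<notin> A" using Cons by (metis dropWhile_eq_Cons_conv)
    moreover have "set (takeWhile (\<lambda>x. x \<in> A) xs) \<subseteq> A"
      by (auto dest: set_takeWhileD)
    ultimately show ?thesis using assms(2) xs by metis
  qed
qed

lemma set_swap_odd: "set r \<subseteq> {z, Suc z} \<Longrightarrow> set (swap_odd z r) \<subseteq> {z, Suc z}"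
  unfolding swap_odd_def by (auto simp: transpose_def)

lemma length_swap_odd [simp]: "length (swap_odd z r) = length r"
  unfolding swap_odd_def by simp

lemma swap_odd_Nil_iff [simp]: "swap_odd z r = [] \<longleftrightarrow> r = []"
  unfolding swap_odd_def by simp

lemma swap_odd_swap_odd [simp]: "swap_odd z (swap_odd z r) = r"
  unfolding swap_odd_def by (simp add: comp_def)

lemma length_flip_blocks: "length (flip_blocks z xs) = length xs"
  by (induction xs rule: block_induct[where A = "{z, Suc z}"])
    (simp_all add: flip_blocks_block flip_blocks_step)

text \<open>Exchanging within a block keeps its length and its alphabet, so the flipped list has the
  same block decomposition.\<close>

lemma flip_blocks_flip_blocks: "flip_blocks z (flip_blocks z xs) = xs"
  by (induction xs rule: block_induct[where A = "{z, Suc z}"])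
    (simp_all only: flip_blocks_block flip_blocks_step[OF set_swap_odd] flip_blocks_step
      set_swap_odd swap_odd_swap_odd not_False_eq_True)

lemma count_list_even_block:
  assumes "set r \<subseteq> {z, Suc z}" "distinct_adj r" "even (length r)"
  shows "count_list r z = count_list r (Suc z)"
  using assms by (induction r rule: induct_list012) (auto dest: distinct_adj_ConsD)

lemma count_list_swap_odd:
  assumes "set r \<subseteq> {z, Suc z}" "distinct_adj r"
  shows "count_list (swap_odd z r) m = count_list r (transpose z (Suc z) m)"
proof (cases "odd (length r)")
  case True
  have "count_list (map (transpose z (Suc z)) r) m
      = count_list r (transpose z (Suc z) m)" for r
    by (induction r) (auto simp: transpose_def)
  then show ?thesis using True unfolding swap_odd_def by simp
next
  case False
  consider "m = z" | "m = Suc z" | "m \<notin> {z, Suc z}" by blast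
  then show ?thesis
    using False count_list_even_block[OF assms]
    by cases (simp_all add: swap_odd_def)
qed

lemma count_list_flip_blocks:
  "distinct_adj xs \<Longrightarrow> count_list (flip_blocks z xs) m = count_list xs (transpose z (Suc z) m)"
proof (induction xs rule: block_induct[where A = "{z, Suc z}"])
  case (block r)
  then show ?case by (simp only: flip_blocks_block count_list_swap_odd)
next
  case (step r x t)
  have "x = m \<longleftrightarrow> x = transpose z (Suc z) m"
    using step.hyps by (auto simp: transpose_def)
  moreover have "distinct_adj r" "distinct_adj t"
    using step.prems by (auto simp: distinct_adj_append_iff distinct_adj_Cons)
  ultimately show ?case
    using step by (simp add: flip_blocks_step count_list_swap_odd)
qed

lemma distinct_adj_swap_odd: "distinct_adj r \<Longrightarrow> distinct_adj (swap_odd z r)"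
  unfolding swap_odd_def by (auto intro!: distinct_adj_mapI inj_on_transpose)

lemma ascents_Cons: "r \<noteq> [] \<Longrightarrow> ascents (x # r) = (if x < hd r then 1 else 0) + ascents r"
  by (cases r) auto

lemma ascents_append_Cons:
  "r \<noteq> [] \<Longrightarrow> ascents (r @ x # t) = ascents r + (if last r < x then 1 else 0) + ascents (x # t)"
  by (induction r rule: induct_list012) auto

lemma ascents_swap_odd:
  assumes "set r \<subseteq> {z, Suc z}" "distinct_adj r"
  shows "ascents (swap_odd z r) = ascents r"
proof -
  have "ascents (map (transpose z (Suc z)) r) = ascents r" if "odd (length r)"
    using that assms
  proof (induction r rule: induct_list012)
    case (3 x y r)
    \<comment> \<open>Odd length provides a third letter, and alternation makes it equal to
      \<open>x\<close>. The first two steps are then one ascent and one descent, before and after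
      the exchange.\<close>
    then obtain u us where "r = u # us" by (cases r) auto
    then show ?case using 3 by (auto simp: distinct_adj_Cons)
  qed auto
  then show ?thesis unfolding swap_odd_def by simp
qed

lemma hd_swap_odd:
  assumes "set r \<subseteq> {z, Suc z}" "r \<noteq> []" "y \<notin> {z, Suc z}"
  shows "y < hd (swap_odd z r) \<longleftrightarrow> y < hd r" "hd (swap_odd z r) \<in> {z, Suc z}"
  using assms by (cases r; auto simp: swap_odd_def transpose_def)+

lemma last_swap_odd:
  assumes "set r \<subseteq> {z, Suc z}" "r \<noteq> []" "y \<notin> {z, Suc z}"
  shows "last (swap_odd z r) < y \<longleftrightarrow> last r < y" "last (swap_odd z r) \<in> {z, Suc z}"
  using assms by (cases r rule: rev_cases; auto simp: swap_odd_def transpose_def)+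

text \<open>The second conjunct strengthens the induction so that it covers the junction with a
  preceding separator: a letter other than \<open>z\<close> and \<open>Suc z\<close> compares in the
  same way with both.\<close>

lemma ascents_flip_blocks_aux:
  "distinct_adj xs \<Longrightarrow> ascents (flip_blocks z xs) = ascents xs \<and>
    (\<forall>y. y \<notin> {z, Suc z} \<longrightarrow> ascents (y # flip_blocks z xs) = ascents (y # xs))"
proof (induction xs rule: block_induct[where A = "{z, Suc z}"])
  case (block r)
  show ?case
  proof (cases "r = []")
    case True
    then show ?thesis by (simp add: flip_blocks_block swap_odd_def)
  next
    case False
    then show ?thesis
      using block ascents_swap_odd[of r z] hd_swap_odd[OF block(1)]
      by (simp add: flip_blocks_block ascents_Cons)
  qed
next
  case (step r x t)
  have d: "distinct_adj r" "distinct_adj t"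
    using step.prems by (auto simp: distinct_adj_append_iff distinct_adj_Cons)
  then have IH: "ascents (x # flip_blocks z t) = ascents (x # t)"
    using step.IH step.hyps(2) by blast
  show ?case
  proof (cases "r = []")
    case True
    then show ?thesis using IH flip_blocks_step[OF step.hyps, of t]
      by (simp add: swap_odd_def)
  next
    case False
    then have "ascents (flip_blocks z (r @ x # t)) = ascents (r @ x # t)"
      using IH ascents_swap_odd[OF step.hyps(1) d(1)] last_swap_odd(1)[OF step.hyps(1) False step.hyps(2)]
      by (simp add: flip_blocks_step[OF step.hyps] ascents_append_Cons)
    moreover have "y < hd (flip_blocks z (r @ x # t)) \<longleftrightarrow> y < hd (r @ x # t)" if "y \<notin> {z, Suc z}" for y
      using hd_swap_odd(1)[OF step.hyps(1) False that] False
      by (simp add: flip_blocks_step[OF step.hyps])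
    moreover have "flip_blocks z (r @ x # t) \<noteq> []"
      by (simp add: flip_blocks_step[OF step.hyps])
    ultimately show ?thesis by (simp add: ascents_Cons)
  qed
qed

lemma ascents_flip_blocks: "distinct_adj xs \<Longrightarrow> ascents (flip_blocks z xs) = ascents xs"
  using ascents_flip_blocks_aux by blast

text \<open>Guards the junction between a separator and the flipped remainder, where equal
  neighbours could otherwise arise.\<close>

lemma hd_flip_blocks:
  assumes "y \<notin> {z, Suc z}" "xs \<noteq> []" "y \<noteq> hd xs"
  shows "y \<noteq> hd (flip_blocks z xs)"
  using assms(2,3)
proof (induction xs rule: block_induct[where A = "{z, Suc z}"])
  case (block r)
  then show ?case using hd_swap_odd(2)[OF block(1) _ assms(1)] assms(1)
    by (auto simp: flip_blocks_block)
next
  case (step r x t)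
  show ?case
  proof (cases "r = []")
    case True
    then show ?thesis using step.prems flip_blocks_step[OF step.hyps, of t]
      by (simp add: swap_odd_def)
  next
    case False
    then show ?thesis using hd_swap_odd(2)[OF step.hyps(1) _ assms(1)] assms(1)
      by (auto simp: flip_blocks_step[OF step.hyps])
  qed
qed

lemma distinct_adj_flip_blocks: "distinct_adj xs \<Longrightarrow> distinct_adj (flip_blocks z xs)"
proof (induction xs rule: block_induct[where A = "{z, Suc z}"])
  case (block r)
  then show ?case by (simp only: flip_blocks_block distinct_adj_swap_odd)
next
  case (step r x t)
  have d: "distinct_adj r" "distinct_adj t" "t = [] \<or> x \<noteq> hd t"
    using step.prems by (auto simp: distinct_adj_append_iff distinct_adj_Cons)
  have "t = [] \<Longrightarrow> flip_blocks z t = []" using length_flip_blocks[of z t] by simp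
  then have "distinct_adj (x # flip_blocks z t)"
    using step.IH d hd_flip_blocks[OF step.hyps(2), of t] by (auto simp: distinct_adj_Cons)
  moreover have "r = [] \<or> last (swap_odd z r) \<noteq> x"
    using last_swap_odd(2)[OF step.hyps(1) _ step.hyps(2)] step.hyps(2) by metis
  ultimately show ?case
    using distinct_adj_swap_odd[OF d(1)]
    by (simp add: flip_blocks_step[OF step.hyps] distinct_adj_append_iff)
qed

section \<open>Counting Smirnov words (no equal neighbours), as lists and as functions\<close>

definition smirnov_lists :: "nat \<Rightarrow> (nat \<Rightarrow> nat) \<Rightarrow> nat \<Rightarrow> nat list set" where
  "smirnov_lists n alpha k =
    {xs. length xs = n \<and> 0 \<notin> set xs \<and> distinct_adj xs \<and> count_list xs = alpha \<and> ascents xs = k}"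

lemma card_smirnov_lists_transpose:
  assumes "1 \<le> z"
  shows "card (smirnov_lists n (alpha \<circ> transpose z (Suc z)) k) = card (smirnov_lists n alpha k)"
proof -
  have maps: "flip_blocks z xs \<in> smirnov_lists n (alpha \<circ> transpose z (Suc z)) k"
    if xs: "xs \<in> smirnov_lists n alpha k" for xs alpha
  proof -
    \<comment> \<open>Since \<open>1 \<le> z\<close>, the transposition fixes 0, so colours stay
      positive.\<close>
    have "count_list (flip_blocks z xs) 0 = count_list xs 0"
      using xs assms count_list_flip_blocks[of xs z 0] unfolding smirnov_lists_def by simp
    then have "0 \<notin> set (flip_blocks z xs)"
      using xs unfolding smirnov_lists_def by (metis (mono_tags, lifting) count_list_0_iff mem_Collect_eq)
    then show ?thesis
      using xs unfolding smirnov_lists_def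
      by (auto simp: length_flip_blocks distinct_adj_flip_blocks ascents_flip_blocks
        count_list_flip_blocks fun_eq_iff)
  qed
  have "bij_betw (flip_blocks z) (smirnov_lists n (alpha \<circ> transpose z (Suc z)) k) (smirnov_lists n alpha k)"
  proof (rule bij_betw_byWitness[where f' = "flip_blocks z"])
    show "flip_blocks z ` smirnov_lists n (alpha \<circ> transpose z (Suc z)) k \<subseteq> smirnov_lists n alpha k"
      proof -
      have "(alpha \<circ> transpose z (Suc z)) \<circ> transpose z (Suc z) = alpha"
        by (simp add: fun_eq_iff)
      then show ?thesis using maps[of _ "alpha \<circ> transpose z (Suc z)"] by force
    qed
    show "flip_blocks z ` smirnov_lists n alpha k \<subseteq> smirnov_lists n (alpha \<circ> transpose z (Suc z)) k"
      using maps by blast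
  qed (simp_all add: flip_blocks_flip_blocks)
  then show ?thesis by (rule bij_betw_same_card)
qed

lemma count_list_map_upt: "count_list (map w [1..<Suc n]) = content n w"
proof
  fix m
  have "{i. w i = m} \<inter> set [1..<Suc n] = {i\<in>{1..n}. w i = m}" by auto
  then show "count_list (map w [1..<Suc n]) m = content n w m"
    unfolding content_def count_list_eq_length_filter
    by (simp add: filter_map distinct_length_filter comp_def eq_commute[of m] del: upt_Suc)
qed

lemma ascents_map_upt: "ascents (map w [1..<Suc n]) = card {i\<in>{1..<n}. w i < w (Suc i)}"
proof (induction n)
  case (Suc n)
  show ?case
  proof (cases "n = 0")
    case False
    have "ascents (map w [1..<Suc (Suc n)]) = ascents (map w [1..<Suc n] @ w (Suc n) # [])"
      by simp
    also have "\<dots> = ascents (map w [1..<Suc n]) + (if w n < w (Suc n) then 1 else 0)"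
      using False by (subst ascents_append_Cons) (auto simp: last_map)
    also have "\<dots> = card {i\<in>{1..<n}. w i < w (Suc i)} + (if w n < w (Suc n) then 1 else 0)"
      by (simp only: Suc)
    also have "\<dots> = card {i\<in>{1..<Suc n}. w i < w (Suc i)}"
    proof -
      have "{i\<in>{1..<Suc n}. w i < w (Suc i)} =
        (if w n < w (Suc n) then insert n {i\<in>{1..<n}. w i < w (Suc i)} else {i\<in>{1..<n}. w i < w (Suc i)})"
        using False by (auto simp: less_Suc_eq)
      then show ?thesis by simp
    qed
    finally show ?thesis .
  qed simp
qed simp

lemma distinct_adj_map_upt: "distinct_adj (map w [1..<Suc n]) \<longleftrightarrow> (\<forall>i\<in>{1..<n}. w i \<noteq> w (Suc i))"
proof -
  have "distinct_adj (map w [1..<Suc n]) \<longleftrightarrow> (\<forall>i<n - 1. w (Suc i) \<noteq> w (Suc (Suc i)))"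
    unfolding distinct_adj_conv_nth by (simp add: less_diff_conv del: upt_Suc)
  also have "\<dots> \<longleftrightarrow> (\<forall>i\<in>{1..<n}. w i \<noteq> w (Suc i))"
  proof
    assume *: "\<forall>i<n - 1. w (Suc i) \<noteq> w (Suc (Suc i))"
    show "\<forall>i\<in>{1..<n}. w i \<noteq> w (Suc i)"
    proof
      fix i assume "i \<in> {1..<n}"
      then have "i - 1 < n - 1" "Suc (i - 1) = i" by auto
      then show "w i \<noteq> w (Suc i)" using * by metis
    qed
  qed simp
  finally show ?thesis .
qed

lemma card_smirnov_lists:
  "card {w \<in> proper_words n. content n w = alpha \<and> card {i\<in>{1..<n}. w i < w (Suc i)} = k}
    = card (smirnov_lists n alpha k)" (is "card ?W = _")
proof -
  let ?f = "\<lambda>w. map w [1..<Suc n]"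
  \<comment> \<open>Positions start at 1 and list indices at 0; the default 0 is the value that
    words take outside the range.\<close>
  let ?g = "\<lambda>xs i. if i \<in> {1..n} then xs ! (i - 1) else (0::nat)"
  have char: "?f w \<in> smirnov_lists n alpha k \<longleftrightarrow> w \<in> ?W" if "\<forall>i. i \<notin> {1..n} \<longrightarrow> w i = 0" for w
  proof -
    have "0 \<notin> set (?f w) \<longleftrightarrow> w \<in> words n"
      using that unfolding words_def by (auto simp: image_iff Suc_le_eq simp del: upt_Suc)
    then show ?thesis
      unfolding smirnov_lists_def proper_words_def mem_Collect_eq count_list_map_upt
        ascents_map_upt distinct_adj_map_upt by auto
  qed
  have fg: "?f (?g xs) = xs" if "length xs = n" for xs
    using that by (intro nth_equalityI) (auto simp del: upt_Suc)
  have "bij_betw ?f ?W (smirnov_lists n alpha k)"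
  proof (rule bij_betw_byWitness[where f' = ?g])
    show "\<forall>w\<in>?W. ?g (?f w) = w"
      unfolding proper_words_def words_def by (auto simp: fun_eq_iff simp del: upt_Suc)
    show "\<forall>xs\<in>smirnov_lists n alpha k. ?f (?g xs) = xs"
      using fg unfolding smirnov_lists_def by blast
    show "?f ` ?W \<subseteq> smirnov_lists n alpha k"
    proof
      fix xs assume "xs \<in> ?f ` ?W"
      then obtain w where "w \<in> ?W" "xs = ?f w" by blast
      moreover from this have "\<forall>i. i \<notin> {1..n} \<longrightarrow> w i = 0"
        unfolding proper_words_def words_def by blast
      ultimately show "xs \<in> smirnov_lists n alpha k" using char by blast
    qed
    show "?g ` smirnov_lists n alpha k \<subseteq> ?W"
    proof
      fix w assume "w \<in> ?g ` smirnov_lists n alpha k"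
      then obtain xs where xs: "xs \<in> smirnov_lists n alpha k" "w = ?g xs" by blast
      then have "?f w = xs" using fg unfolding smirnov_lists_def by blast
      moreover have "\<forall>i. i \<notin> {1..n} \<longrightarrow> w i = 0" using xs by auto
      ultimately show "w \<in> ?W" using char xs by blast
    qed
  qed
  then show ?thesis by (rule bij_betw_same_card)
qed

lemma cqf_symmetric_identity: "cqf_symmetric n (path_edges n id)"
proof (rule cqf_symmetric_if_adjacent)
  fix z alpha k assume "1 \<le> (z::nat)"
  then show "cqf_coeff n (path_edges n id) (alpha \<circ> transpose z (Suc z)) k
      = cqf_coeff n (path_edges n id) alpha k"
    unfolding cqf_coeff_path[OF permutes_id]
    using card_smirnov_lists_transpose[of z n alpha k] card_smirnov_lists[of n _ k] by simp
qed

subsection \<open>Words increasing along runs\<close>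

text \<open>Descending steps are left unconstrained, so the runs are independent strictly increasing
  sequences. The generating function by content is the product of the elementary symmetric functions
  indexed by the run lengths.\<close>

definition run_words :: "nat \<Rightarrow> (nat \<Rightarrow> bool) \<Rightarrow> (nat \<Rightarrow> nat) set" where
  "run_words n up = {w \<in> words n. \<forall>i\<in>{1..<n}. up i \<longrightarrow> w i < w (Suc i)}"

text \<open>No range checks are needed in the next definition because words vanish outside {1..n} and it is
  only used for z \<ge> 1.\<close>

definition bender_knuth :: "nat \<Rightarrow> (nat \<Rightarrow> bool) \<Rightarrow> (nat \<Rightarrow> nat) \<Rightarrow> nat \<Rightarrow> nat" where
  "bender_knuth z up w i =
    (if w i = z then (if up i \<and> w (Suc i) = Suc z then z else Suc z)
     else if w i = Suc z then (if up (i - 1) \<and> w (i - 1) = z then Suc z else z)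
     else w i)"

lemma words_iff: "w \<in> words n \<longleftrightarrow> (\<forall>i. 0 < w i \<longleftrightarrow> i \<in> {1..n})"
proof
  assume w: "w \<in> words n"
  show "\<forall>i. 0 < w i \<longleftrightarrow> i \<in> {1..n}"
  proof
    fix i
    show "0 < w i \<longleftrightarrow> i \<in> {1..n}"
    proof (cases "i \<in> {1..n}")
      case True
      then have "1 \<le> w i" using w unfolding words_def by blast
      then show ?thesis using True by simp
    next
      case False
      then have "w i = 0" using w unfolding words_def by blast
      then show ?thesis using False by simp
    qed
  qed
next
  assume pos: "\<forall>i. 0 < w i \<longleftrightarrow> i \<in> {1..n}"
  have "1 \<le> w i" if "i \<in> {1..n}" for i using pos that by (simp add: Suc_le_eq)
  moreover have "w i = 0" if "i \<notin> {1..n}" for i using pos that by blast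
  ultimately show "w \<in> words n" unfolding words_def by blast
qed

lemma words_pos: "w \<in> words n \<Longrightarrow> 0 < w i \<longleftrightarrow> i \<in> {1..n}"
  unfolding words_iff by blast

lemma run_words_less:
  assumes "w \<in> run_words n up" "up i" "0 < w i" "0 < w (Suc i)"
  shows "w i < w (Suc i)"
proof -
  have w: "w \<in> words n" using assms(1) unfolding run_words_def by simp
  have "i \<in> {1..<n}" using words_pos[OF w] assms(3,4) by force
  then show ?thesis using assms(1,2) unfolding run_words_def by blast
qed

lemma bender_knuth_pos: "1 \<le> z \<Longrightarrow> 0 < bender_knuth z up w i \<longleftrightarrow> 0 < w i"
  unfolding bender_knuth_def by auto

text \<open>A run contains \<open>z\<close> and \<open>Suc z\<close> at most once each, and next to
  each other if both occur. Such a pair is kept and a lone letter is exchanged; no colour lies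
  strictly between the two, so the run stays increasing.\<close>

lemma bender_knuth_run_words:
  assumes z: "1 \<le> z" and w: "w \<in> run_words n up"
  shows "bender_knuth z up w \<in> run_words n up"
proof -
  have "w \<in> words n" using w unfolding run_words_def by simp
  then have "bender_knuth z up w \<in> words n"
    by (simp add: words_iff bender_knuth_pos[OF z])
  moreover have "bender_knuth z up w i < bender_knuth z up w (Suc i)" if "i \<in> {1..<n}" "up i" for i
  proof -
    have "w i < w (Suc i)" using w that unfolding run_words_def by blast
    then show ?thesis using that(2) unfolding bender_knuth_def by auto
  qed
  ultimately show ?thesis unfolding run_words_def by blast
qed

lemma bender_knuth_involution:
  assumes z: "1 \<le> z" and w: "w \<in> run_words n up"
  shows "bender_knuth z up (bender_knuth z up w) = w"
proof
  fix i
  let ?v = "bender_knuth z up w"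
  have w0: "w 0 = 0" using w unfolding run_words_def words_def by simp
  consider (a) "w i = z" "up i" "w (Suc i) = Suc z"
    | (b) "w i = z" "\<not> (up i \<and> w (Suc i) = Suc z)"
    | (c) "w i = Suc z" "up (i - 1)" "w (i - 1) = z"
    | (d) "w i = Suc z" "\<not> (up (i - 1) \<and> w (i - 1) = z)"
    | (e) "w i \<noteq> z" "w i \<noteq> Suc z" by blast
  then show "bender_knuth z up ?v i = w i"
  proof cases
    case a
    then have "?v i = z" "?v (Suc i) = Suc z" unfolding bender_knuth_def by auto
    then show ?thesis using a by (simp add: bender_knuth_def[of z up ?v])
  next
    case b
    have "i \<noteq> 0" using b w0 z by (cases i) auto
    \<comment> \<open>A lone letter stays lone: its predecessor in the run is below
      \<open>z\<close>, hence is not changed and cannot become \<open>z\<close>.\<close>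
    have "\<not> (up (i - 1) \<and> ?v (i - 1) = z)"
    proof
      assume *: "up (i - 1) \<and> ?v (i - 1) = z"
      then have "0 < w (i - 1)" using z bender_knuth_pos[OF z] by (metis less_le_trans zero_less_one)
      then have "w (i - 1) < z"
        using run_words_less[OF w, of "i - 1"] * b z \<open>i \<noteq> 0\<close> by simp
      then have "?v (i - 1) = w (i - 1)" unfolding bender_knuth_def by simp
      then show False using * \<open>w (i - 1) < z\<close> by simp
    qed
    moreover have "?v i = Suc z" using b unfolding bender_knuth_def by auto
    ultimately show ?thesis using b by (simp add: bender_knuth_def[of z up ?v])
  next
    case c
    have "i \<noteq> 0" using c w0 z by (cases i) auto
    then have "?v i = Suc z" "?v (i - 1) = z" using c unfolding bender_knuth_def by auto
    then show ?thesis using c by (simp add: bender_knuth_def[of z up ?v])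
  next
    case d
    \<comment> \<open>Dually, the successor in the run exceeds \<open>Suc z\<close> and is not
      changed.\<close>
    have "\<not> (up i \<and> ?v (Suc i) = Suc z)"
    proof
      assume *: "up i \<and> ?v (Suc i) = Suc z"
      then have "0 < w (Suc i)" using z bender_knuth_pos[OF z] by (metis zero_less_Suc)
      then have "Suc z < w (Suc i)" using run_words_less[OF w, of i] * d by simp
      then have "?v (Suc i) = w (Suc i)" unfolding bender_knuth_def by simp
      then show False using * \<open>Suc z < w (Suc i)\<close> by simp
    qed
    moreover have "?v i = z" using d unfolding bender_knuth_def by auto
    ultimately show ?thesis using d by (simp add: bender_knuth_def[of z up ?v])
  next
    case e
    then have "?v i = w i" unfolding bender_knuth_def by simp
    then show ?thesis using e by (simp add: bender_knuth_def[of z up ?v])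
  qed
qed

lemma content_bender_knuth:
  assumes z: "1 \<le> z" and w: "w \<in> words n"
  shows "content n (bender_knuth z up w) = content n w \<circ> transpose z (Suc z)"
proof
  fix m
  let ?v = "bender_knuth z up w"
  \<comment> \<open>\<open>?lo\<close> and \<open>?hi\<close> are the two halves of the kept pairs,
    matched by the shift \<open>Suc\<close>; \<open>?lo'\<close> and \<open>?hi'\<close> are the
    lone letters, which trade colours.\<close>
  let ?lo = "{i\<in>{1..n}. w i = z \<and> up i \<and> w (Suc i) = Suc z}"
  let ?hi = "{i\<in>{1..n}. w i = Suc z \<and> up (i - 1) \<and> w (i - 1) = z}"
  let ?lo' = "{i\<in>{1..n}. w i = z \<and> \<not> (up i \<and> w (Suc i) = Suc z)}"
  let ?hi' = "{i\<in>{1..n}. w i = Suc z \<and> \<not> (up (i - 1) \<and> w (i - 1) = z)}"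
  have in_range: "i \<in> {1..n}" if "w i = z \<or> w i = Suc z" for i
    using that z words_pos[OF w, of i] by auto
  have "?hi = Suc ` ?lo"
  proof
    show "?hi \<subseteq> Suc ` ?lo"
    proof
      fix i assume i: "i \<in> ?hi"
      then have "i - 1 \<in> ?lo" "i = Suc (i - 1)" using in_range[of "i - 1"] by auto
      then show "i \<in> Suc ` ?lo" by blast
    qed
    show "Suc ` ?lo \<subseteq> ?hi" using in_range by auto
  qed
  then have lohi: "card ?hi = card ?lo" by (simp add: card_image)
  have un: "card (A \<union> B) = card A + card B"
    if "A \<subseteq> {1..n}" "B \<subseteq> {1..n}" "A \<inter> B = {}" for A B :: "nat set"
    using that by (intro card_Un_disjoint) (auto intro: finite_subset[OF _ finite_atLeastAtMost])
  consider "m = z" | "m = Suc z" | "m \<notin> {z, Suc z}" by blast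
  then show "content n ?v m = (content n w \<circ> transpose z (Suc z)) m"
  proof cases
    case 1
    have "{i\<in>{1..n}. ?v i = z} = ?lo \<union> ?hi'" "{i\<in>{1..n}. w i = Suc z} = ?hi \<union> ?hi'"
      unfolding bender_knuth_def by auto
    moreover have "card (?lo \<union> ?hi') = card ?lo + card ?hi'" "card (?hi \<union> ?hi') = card ?hi + card ?hi'"
      by (rule un; auto)+
    ultimately show ?thesis using 1 lohi unfolding content_def by simp
  next
    case 2
    have "{i\<in>{1..n}. ?v i = Suc z} = ?hi \<union> ?lo'" "{i\<in>{1..n}. w i = z} = ?lo \<union> ?lo'"
      unfolding bender_knuth_def by auto
    moreover have "card (?hi \<union> ?lo') = card ?hi + card ?lo'" "card (?lo \<union> ?lo') = card ?lo + card ?lo'"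
      by (rule un; auto)+
    ultimately show ?thesis using 2 lohi unfolding content_def by simp
  next
    case 3
    then have "{i\<in>{1..n}. ?v i = m} = {i\<in>{1..n}. w i = m}"
      unfolding bender_knuth_def by auto
    then show ?thesis using 3 unfolding content_def by simp
  qed
qed

lemma card_run_words_adjacent:
  assumes z: "1 \<le> z"
  shows "card {w \<in> run_words n up. content n w = alpha \<circ> transpose z (Suc z)}
    = card {w \<in> run_words n up. content n w = alpha}" (is "card (?S (alpha \<circ> _)) = _")
proof -
  have maps: "bender_knuth z up w \<in> ?S (alpha \<circ> transpose z (Suc z))" if "w \<in> ?S alpha" for w alpha
    using that bender_knuth_run_words[OF z] content_bender_knuth[OF z, of w n up]
    unfolding run_words_def by auto
  have "bij_betw (bender_knuth z up) (?S (alpha \<circ> transpose z (Suc z))) (?S alpha)"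
  proof (rule bij_betw_byWitness[where f' = "bender_knuth z up"])
    have "(alpha \<circ> transpose z (Suc z)) \<circ> transpose z (Suc z) = alpha"
      by (simp add: fun_eq_iff)
    then show "bender_knuth z up ` ?S (alpha \<circ> transpose z (Suc z)) \<subseteq> ?S alpha"
      using maps[of _ "alpha \<circ> transpose z (Suc z)"] by auto
    show "bender_knuth z up ` ?S alpha \<subseteq> ?S (alpha \<circ> transpose z (Suc z))"
      using maps by blast
  qed (use bender_knuth_involution[OF z] in blast)+
  then show ?thesis by (rule bij_betw_same_card)
qed

lemma card_run_words_transpose:
  assumes "1 \<le> d"
  shows "card {w \<in> run_words n up. content n w = alpha \<circ> transpose 1 d}
    = card {w \<in> run_words n up. content n w = alpha}"
proof -
  define G where "G alpha = card {w \<in> run_words n up. content n w = alpha}" for alpha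
  have "G (alpha \<circ> transpose 1 d) = G alpha"
    by (rule transpose_invariant_if_adjacent[of G])
      (use assms in \<open>simp_all only: G_def card_run_words_adjacent order_refl\<close>)
  then show ?thesis unfolding G_def .
qed

subsection \<open>Colour classes of aligned words\<close>

definition minima :: "nat \<Rightarrow> (nat \<Rightarrow> bool) \<Rightarrow> nat set" where
  "minima n up = {i\<in>{1..n}. (i = 1 \<or> \<not> up (i - 1)) \<and> (i = n \<or> up i)}"

definition maxima :: "nat \<Rightarrow> (nat \<Rightarrow> bool) \<Rightarrow> nat set" where
  "maxima n up = {i\<in>{1..n}. (i = 1 \<or> up (i - 1)) \<and> (i = n \<or> \<not> up i)}"

lemma minima_maxima_subset: "minima n up \<subseteq> {1..n}" "maxima n up \<subseteq> {1..n}"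
  unfolding minima_def maxima_def by auto

lemma finite_minima_maxima [simp]: "finite (minima n up)" "finite (maxima n up)"
  by (rule finite_subset[OF minima_maxima_subset(1)] finite_subset[OF minima_maxima_subset(2)]; simp)+

lemma card_Int_atMost_Suc:
  "card (A \<inter> {..Suc j}) = card (A \<inter> {..j}) + (if Suc j \<in> A then 1 else 0)"
proof (cases "Suc j \<in> A")
  case True
  then have "A \<inter> {..Suc j} = insert (Suc j) (A \<inter> {..j})" by (auto simp: le_Suc_eq)
  then show ?thesis using True by simp
next
  case False
  then have "A \<inter> {..Suc j} = A \<inter> {..j}" by (auto simp: le_Suc_eq)
  then show ?thesis using False by simp
qed

text \<open>Local minima and maxima alternate along the path, so their numbers in a prefix differ by
  at most one; the directions of the first step and of step \<open>j\<close> decide how. The summand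
  1 avoids subtraction.\<close>

lemma card_minima_prefix:
  assumes "1 \<le> j" "j < n"
  shows "card (minima n up \<inter> {..j}) + 1
    = card (maxima n up \<inter> {..j}) + (if up j then 1 else 0) + (if up 1 then 1 else 0)"
  using assms
proof (induction j rule: nat_induct_at_least)
  case base
  have "minima n up \<inter> {..0} = {}" "maxima n up \<inter> {..0} = {}"
    using minima_maxima_subset[of n up] by auto
  moreover have "1 \<in> minima n up \<longleftrightarrow> up 1" "1 \<in> maxima n up \<longleftrightarrow> \<not> up 1"
    using base unfolding minima_def maxima_def by auto
  ultimately show ?case
    using card_Int_atMost_Suc[of "minima n up" 0] card_Int_atMost_Suc[of "maxima n up" 0] by simp
next
  case (Suc j)
  have "Suc j \<in> minima n up \<longleftrightarrow> \<not> up j \<and> up (Suc j)" "Suc j \<in> maxima n up \<longleftrightarrow> up j \<and> \<not> up (Suc j)"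
    using Suc.prems Suc.hyps unfolding minima_def maxima_def by auto
  then show ?case
    using Suc card_Int_atMost_Suc[of "minima n up" j] card_Int_atMost_Suc[of "maxima n up" j] by auto
qed

text \<open>Adds the last position to the prefix count. Its use: equally many minima and maxima
  force the first and the last step to go the same way.\<close>

lemma card_minima_maxima:
  assumes "2 \<le> n"
  shows "card (minima n up) + (if up (n - 1) then 1 else 0) = card (maxima n up) + (if up 1 then 1 else 0)"
proof -
  have n: "Suc (n - 1) = n" using assms by simp
  have "minima n up \<inter> {..n} = minima n up" "maxima n up \<inter> {..n} = maxima n up"
    using minima_maxima_subset[of n up] by auto
  moreover have "n \<in> minima n up \<longleftrightarrow> \<not> up (n - 1)" "n \<in> maxima n up \<longleftrightarrow> up (n - 1)"
    using assms unfolding minima_def maxima_def by auto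
  ultimately show ?thesis
    using card_minima_prefix[of "n - 1" n up] assms
      card_Int_atMost_Suc[of "minima n up" "n - 1"] card_Int_atMost_Suc[of "maxima n up" "n - 1"]
    unfolding n by (auto split: if_splits)
qed

text \<open>Symmetry in the top power equates the numbers of aligned words of both contents, and
  \<open>w\<close> shows that one of them is nonzero.\<close>

lemma aligned_words_rearrange:
  assumes sigma: "sigma permutes {1..n}" and sym: "cqf_symmetric n (path_edges n sigma)"
    and w: "w \<in> aligned_words n (\<lambda>i. sigma i < sigma (Suc i))" and p: "p permutes {1..}"
  obtains v where "v \<in> aligned_words n (\<lambda>i. sigma i < sigma (Suc i))" "content n v = content n w \<circ> p"
proof -
  let ?N = "\<lambda>alpha. {v \<in> aligned_words n (\<lambda>i. sigma i < sigma (Suc i)). content n v = alpha}"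
  have fin: "finite (?N alpha)" for alpha
    by (rule finite_subset[OF _ finite_words_content[of n alpha]]) (auto simp: aligned_words_def)
  have "card (?N (content n w \<circ> p)) = card (?N (content n w))"
    using sym p unfolding cqf_symmetric_def cqf_coeff_path_top[OF sigma, symmetric] by blast
  moreover have "w \<in> ?N (content n w)" using w by simp
  then have "card (?N (content n w)) \<noteq> 0"
    using fin[of "content n w"] by (auto simp only: card_eq_0_iff)
  ultimately have "?N (content n w \<circ> p) \<noteq> {}" by (metis card.empty)
  then show ?thesis using that by blast
qed

text \<open>Trading colours 1 and \<open>m\<close> yields an aligned word whose colour 1 is as
  frequent as \<open>m\<close> was in \<open>w\<close>. No neighbour can be below 1, so each such
  position is a local minimum.\<close>

lemma class_le_minima:
  assumes sigma: "sigma permutes {1..n}" and sym: "cqf_symmetric n (path_edges n sigma)"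
    and w: "w \<in> aligned_words n (\<lambda>i. sigma i < sigma (Suc i))" and m: "1 \<le> m"
  shows "content n w m \<le> card (minima n (\<lambda>i. sigma i < sigma (Suc i)))"
proof -
  let ?up = "\<lambda>i. sigma i < sigma (Suc i)"
  have "transpose 1 m permutes {1..}" using m by (intro permutes_swap_id) auto
  then obtain v where v: "v \<in> aligned_words n ?up" "content n v = content n w \<circ> transpose 1 m"
    using aligned_words_rearrange[OF sigma sym w] by blast
  have pos: "1 \<le> v i" if "i \<in> {1..n}" for i
    using v that unfolding aligned_words_def words_def by blast
  have step: "if ?up i then v i < v (Suc i) else v (Suc i) < v i" if "i \<in> {1..<n}" for i
    using v that unfolding aligned_words_def by blast
  have "{i\<in>{1..n}. v i = 1} \<subseteq> minima n ?up"
  proof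
    fix i assume "i \<in> {i\<in>{1..n}. v i = 1}"
    then have i: "i \<in> {1..n}" "v i = 1" by auto
    have "\<not> ?up (i - 1)" if "i \<noteq> 1"
    proof
      assume "?up (i - 1)"
      moreover have pred: "i - 1 \<in> {1..<n}" "Suc (i - 1) = i" using i that by auto
      ultimately have "v (i - 1) < v i" using step[of "i - 1"] by simp
      then show False using pos[of "i - 1"] i pred(1) by simp
    qed
    moreover have "?up i" if "i \<noteq> n"
    proof (rule ccontr)
      assume "\<not> ?up i"
      then have "v (Suc i) < v i" using step[of i] i that by auto
      then show False using pos[of "Suc i"] i that by auto
    qed
    ultimately show "i \<in> minima n ?up" using i(1) unfolding minima_def by blast
  qed
  then have "content n v 1 \<le> card (minima n ?up)"
    unfolding content_def by (simp add: card_mono)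
  then show ?thesis using v by simp
qed

text \<open>The dual argument lacks a largest colour to trade with. A colour \<open>B\<close> above
  \<open>m\<close> and all colours of \<open>w\<close> is chosen; after the trade no letter exceeds
  \<open>B\<close>, so its positions are local maxima.\<close>

lemma class_le_maxima:
  assumes sigma: "sigma permutes {1..n}" and sym: "cqf_symmetric n (path_edges n sigma)"
    and w: "w \<in> aligned_words n (\<lambda>i. sigma i < sigma (Suc i))" and m: "1 \<le> m"
  shows "content n w m \<le> card (maxima n (\<lambda>i. sigma i < sigma (Suc i)))"
proof -
  let ?up = "\<lambda>i. sigma i < sigma (Suc i)"
  define B where "B = Suc (Max (insert m (w ` {1..n})))"
  have B: "m < B" "\<And>i. i \<in> {1..n} \<Longrightarrow> w i < B"
    unfolding B_def less_Suc_eq_le by (rule Max_ge; simp)+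
  have "transpose m B permutes {1..}" using m B by (intro permutes_swap_id) auto
  then obtain v where v: "v \<in> aligned_words n ?up" "content n v = content n w \<circ> transpose m B"
    using aligned_words_rearrange[OF sigma sym w] by blast
  have le: "v i \<le> B" if "i \<in> {1..n}" for i
  proof (rule ccontr)
    assume "\<not> v i \<le> B"
    then have "content n v (v i) = content n w (v i)" using v B(1) by simp
    moreover have "content n w (v i) = 0"
      using B(2) \<open>\<not> v i \<le> B\<close> unfolding content_def by (force simp: card_eq_0_iff)
    moreover have "content n v (v i) \<noteq> 0" using that unfolding content_def by auto
    ultimately show False by simp
  qed
  have step: "if ?up i then v i < v (Suc i) else v (Suc i) < v i" if "i \<in> {1..<n}" for i
    using v that unfolding aligned_words_def by blast
  have "{i\<in>{1..n}. v i = B} \<subseteq> maxima n ?up"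
  proof
    fix i assume "i \<in> {i\<in>{1..n}. v i = B}"
    then have i: "i \<in> {1..n}" "v i = B" by auto
    have "?up (i - 1)" if "i \<noteq> 1"
    proof (rule ccontr)
      assume "\<not> ?up (i - 1)"
      moreover have pred: "i - 1 \<in> {1..<n}" "Suc (i - 1) = i" using i that by auto
      ultimately have "v i < v (i - 1)" using step[of "i - 1"] by simp
      then show False using le[of "i - 1"] i pred(1) by simp
    qed
    moreover have "\<not> ?up i" if "i \<noteq> n"
    proof
      assume "?up i"
      then have "v i < v (Suc i)" using step[of i] i that by auto
      then show False using le[of "Suc i"] i that by auto
    qed
    ultimately show "i \<in> maxima n ?up" using i(1) unfolding maxima_def by blast
  qed
  then have "content n v B \<le> card (maxima n ?up)"
    unfolding content_def by (simp add: card_mono)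
  then show ?thesis using v by simp
qed

section \<open>Step directions forced by symmetry\<close>

lemma permutes_Suc_neq: "sigma permutes S \<Longrightarrow> sigma (Suc i) \<noteq> sigma i"
  using permutes_inj[of sigma S] by (metis injD n_not_Suc_n)

lemma aligned_words_cutI:
  assumes "\<And>i. i \<in> {1..n} \<Longrightarrow> 0 < f i"
    and "\<And>i. i \<in> {1..<n} \<Longrightarrow> up i \<Longrightarrow> f i < f (Suc i)"
    and "\<And>i. i \<in> {1..<n} \<Longrightarrow> \<not> up i \<Longrightarrow> f (Suc i) < f i"
  shows "(\<lambda>i. if i \<in> {1..n} then f i else 0) \<in> aligned_words n up"
proof -
  have "(\<lambda>i. if i \<in> {1..n} then f i else 0) \<in> words n"
    unfolding words_iff using assms(1) by simp
  then show ?thesis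
    unfolding aligned_words_def using assms(2,3) by simp
qed

lemma content_cut: "content n (\<lambda>i. if i \<in> {1..n} then f i else 0) = content n f"
proof
  fix m
  have "{i\<in>{1..n}. (if i \<in> {1..n} then f i else 0) = m} = {i\<in>{1..n}. f i = m}" by auto
  then show "content n (\<lambda>i. if i \<in> {1..n} then f i else 0) m = content n f m"
    unfolding content_def by (rule arg_cong)
qed

lemma symmetric_imp_card_minima_eq_maxima:
  assumes sigma: "sigma permutes {1..n}" and sym: "cqf_symmetric n (path_edges n sigma)"
  defines "up \<equiv> \<lambda>i. sigma i < sigma (Suc i)"
  shows "card (minima n up) = card (maxima n up)"
proof (rule antisym)
  have rng: "1 \<le> sigma i" "sigma i \<le> n" if "i \<in> {1..n}" for i
    using permutes_in_image[OF sigma, of i] that by auto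
  have down: "sigma (Suc i) < sigma i" if "\<not> up i" for i
    using that permutes_Suc_neq[OF sigma, of i] unfolding up_def by simp
  show "card (minima n up) \<le> card (maxima n up)"
  proof -
    \<comment> \<open>The labeling itself is aligned. Lowering all its minima to one common smallest
      colour keeps every direction and makes them a single class; the shift by \<open>Suc\<close>
      keeps colour 1 free for them.\<close>
    let ?f = "\<lambda>i. if i \<in> minima n up then 1 else Suc (sigma i)"
    have "(\<lambda>i. if i \<in> {1..n} then ?f i else 0) \<in> aligned_words n up"
    proof (rule aligned_words_cutI)
      fix i assume i: "i \<in> {1..<n}" "up i"
      then have "Suc i \<notin> minima n up" unfolding minima_def by simp
      then show "?f i < ?f (Suc i)" using i rng[of "Suc i"] unfolding up_def by simp
    next
      fix i assume i: "i \<in> {1..<n}" "\<not> up i"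
      then have "i \<notin> minima n up" unfolding minima_def by simp
      then show "?f (Suc i) < ?f i" using i rng[of i] down[of i] by simp
    qed simp
    from class_le_maxima[OF sigma sym this[unfolded up_def] order_refl]
    have "content n ?f 1 \<le> card (maxima n up)" unfolding content_cut up_def .
    moreover have "?f i = 1 \<longleftrightarrow> i \<in> minima n up" if "i \<in> {1..n}" for i
      using rng[OF that] by auto
    then have "{i\<in>{1..n}. ?f i = 1} = minima n up"
      using minima_maxima_subset[of n up] by blast
    ultimately show ?thesis unfolding content_def by (simp only:)
  qed
  show "card (maxima n up) \<le> card (minima n up)"
  proof -
    \<comment> \<open>Dually, all maxima are raised to a common colour above every label.\<close>
    let ?f = "\<lambda>i. if i \<in> maxima n up then Suc n else sigma i"
    have "(\<lambda>i. if i \<in> {1..n} then ?f i else 0) \<in> aligned_words n up"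
    proof (rule aligned_words_cutI)
      fix i assume i: "i \<in> {1..<n}" "up i"
      then have "i \<notin> maxima n up" unfolding maxima_def by simp
      then show "?f i < ?f (Suc i)" using i rng[of i] unfolding up_def by simp
    next
      fix i assume i: "i \<in> {1..<n}" "\<not> up i"
      then have "Suc i \<notin> maxima n up" unfolding maxima_def by simp
      then show "?f (Suc i) < ?f i" using i rng[of "Suc i"] down[of i] by simp
    next
      fix i assume "i \<in> {1..n}"
      then show "0 < ?f i" using rng[of i] by simp
    qed
    from class_le_minima[OF sigma sym this[unfolded up_def], of "Suc n"]
    have "content n ?f (Suc n) \<le> card (minima n up)" unfolding content_cut up_def by linarith
    moreover have "?f i = Suc n \<longleftrightarrow> i \<in> maxima n up" if "i \<in> {1..n}" for i
      using rng[OF that] by auto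
    then have "{i\<in>{1..n}. ?f i = Suc n} = maxima n up"
      using minima_maxima_subset[of n up] by blast
    ultimately show ?thesis unfolding content_def by (simp only:)
  qed
qed

text \<open>A double descent allows a colour class that is too large. As the first step goes up and
  step \<open>j\<close> goes down, the prefix up to \<open>j\<close> has as many minima as maxima;
  its minima, the middle of the double descent and the later maxima thus exceed the number of maxima
  by one.\<close>

lemma symmetric_imp_no_double_descent:
  assumes sigma: "sigma permutes {1..n}" and sym: "cqf_symmetric n (path_edges n sigma)"
  defines "up \<equiv> \<lambda>i. sigma i < sigma (Suc i)"
  assumes start: "up 1" and j: "1 \<le> j" "Suc j < n" "\<not> up j"
  shows "up (Suc j)"
proof (rule ccontr)
  assume j': "\<not> up (Suc j)"
  have rng: "1 \<le> sigma i" "sigma i \<le> n" if "i \<in> {1..n}" for i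
    using permutes_in_image[OF sigma, of i] that by auto
  have down: "sigma (Suc i) < sigma i" if "\<not> up i" for i
    using that permutes_Suc_neq[OF sigma, of i] unfolding up_def by simp
  let ?M = "minima n up" and ?X = "maxima n up"
  \<comment> \<open>The minima left of the double descent, its middle, and the maxima right of it form a colour class.\<close>
  let ?f = "\<lambda>i. if i \<le> j then (if i \<in> ?M then Suc n else Suc n + sigma i)
    else if i = Suc j then Suc n else (if i \<in> ?X then Suc n else sigma i)"
  have notin: "j \<notin> ?M" "Suc (Suc j) \<notin> ?X" "Suc j \<notin> ?X"
    using j j' unfolding minima_def maxima_def by auto
  have "(\<lambda>i. if i \<in> {1..n} then ?f i else 0) \<in> aligned_words n up"
  proof (rule aligned_words_cutI)
    fix i assume i: "i \<in> {1..<n}" "up i"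
    then have "Suc i \<notin> ?M" "i \<notin> ?X" "i \<noteq> j" "i \<noteq> Suc j"
      using j j' unfolding minima_def maxima_def by auto
    then show "?f i < ?f (Suc i)" using i rng[of i] rng[of "Suc i"] unfolding up_def by auto
  next
    fix i assume i: "i \<in> {1..<n}" "\<not> up i"
    then have "i \<notin> ?M" "Suc i \<notin> ?X" unfolding minima_def maxima_def by auto
    then show "?f (Suc i) < ?f i" using i rng[of i] rng[of "Suc i"] down[of i] notin by auto
  next
    fix i assume "i \<in> {1..n}"
    then show "0 < ?f i" using rng[of i] by simp
  qed
  from class_le_maxima[OF sigma sym this[unfolded up_def], of "Suc n"]
  have le: "content n ?f (Suc n) \<le> card ?X" unfolding content_cut up_def by linarith
  have "{i\<in>{1..n}. ?f i = Suc n} = (?M \<inter> {..j}) \<union> insert (Suc j) (?X - {..j})"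
  proof -
    have "?f i = Suc n \<longleftrightarrow> i \<in> (?M \<inter> {..j}) \<union> insert (Suc j) (?X - {..j})" if "i \<in> {1..n}" for i
      using rng[OF that] by auto
    moreover have "(?M \<inter> {..j}) \<union> insert (Suc j) (?X - {..j}) \<subseteq> {1..n}"
      using minima_maxima_subset[of n up] j by auto
    ultimately show ?thesis by blast
  qed
  then have "content n ?f (Suc n) = card ((?M \<inter> {..j}) \<union> insert (Suc j) (?X - {..j}))"
    unfolding content_def by (rule arg_cong)
  also have "\<dots> = card (?M \<inter> {..j}) + card (insert (Suc j) (?X - {..j}))"
    by (rule card_Un_disjoint) auto
  also have "card (insert (Suc j) (?X - {..j})) = Suc (card (?X - {..j}))"
    using notin by simp
  also have "card (?M \<inter> {..j}) = card (?X \<inter> {..j})"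
    using card_minima_prefix[of j n up] j start by simp
  also have "card (?X \<inter> {..j}) + Suc (card (?X - {..j})) = Suc (card ?X)"
    using card_Int_Diff[of ?X "{..j}"] by simp
  finally show False using le by simp
qed

text \<open>Aligned words form a subset of the run words. Trading colours 1 and \<open>d\<close>
  preserves both counts, one by the assumed symmetry and the other by the Bender-Knuth involution. A
  descent gives a content where the subset is proper before the trade, while the two sets coincide
  after it.\<close>

lemma symmetric_isolated_descents_imp_increasing:
  assumes sigma: "sigma permutes {1..n}" and sym: "cqf_symmetric n (path_edges n sigma)"
  defines "up \<equiv> \<lambda>i. sigma i < sigma (Suc i)"
  assumes start: "up 1" and finish: "up (n - 1)"
    and isolated: "\<And>j. 1 \<le> j \<Longrightarrow> Suc j < n \<Longrightarrow> \<not> up j \<Longrightarrow> up (Suc j)"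
    and e: "e \<in> {1..<n}"
  shows "up e"
proof (rule ccontr)
  assume "\<not> up e"
  \<comment> \<open>The first descent, so that the first run is exactly
    \<open>{1..d}\<close>.\<close>
  define d where "d = (LEAST d. 1 \<le> d \<and> \<not> up d)"
  have d: "1 \<le> d" "\<not> up d"
    using LeastI[of "\<lambda>d. 1 \<le> d \<and> \<not> up d" e] \<open>\<not> up e\<close> e unfolding d_def by auto
  have before: "up i" if "1 \<le> i" "i < d" for i
    using not_less_Least[of i "\<lambda>d. 1 \<le> d \<and> \<not> up d"] that unfolding d_def by blast
  have "d \<le> e" using Least_le[of "\<lambda>d. 1 \<le> d \<and> \<not> up d" e] \<open>\<not> up e\<close> e unfolding d_def by auto
  then have dn: "d < n" using e by simp
  define bot where "bot = {i\<in>{1..n}. i = 1 \<or> \<not> up (i - 1)}"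
  have fin_bot: "finite bot" unfolding bot_def by simp
  \<comment> \<open>Since descents are isolated and the last step goes up, every run has at least
    two positions; hence a bottom is never the upper end of a descent.\<close>
  have bot_up: "i < n \<and> up i" if "i \<in> bot" for i
  proof -
    have "i \<noteq> n" using that finish e unfolding bot_def by auto
    moreover have "up i"
    proof (cases "i = 1")
      case False
      then have "\<not> up (i - 1)" "1 \<le> i - 1" "Suc (i - 1) = i" "i \<le> n"
        using that unfolding bot_def by auto
      then show ?thesis using isolated[of "i - 1"] \<open>i \<noteq> n\<close> by simp
    qed (use start in simp)
    ultimately show ?thesis using that unfolding bot_def by auto
  qed
  let ?S = "\<lambda>alpha. {w \<in> run_words n up. content n w = alpha}"
  let ?N = "\<lambda>alpha. {w \<in> aligned_words n up. content n w = alpha}"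
  have NS: "?N alpha \<subseteq> ?S alpha" for alpha
    unfolding aligned_words_def run_words_def by auto
  have finS: "finite (?S alpha)" for alpha
    by (rule finite_subset[OF _ finite_words_content[of n alpha]]) (auto simp: run_words_def)

  \<comment> \<open>The class of colour d consists of the top of the first run and the bottoms of all other runs.\<close>
  define f where "f i = (if i \<le> d then i else if i \<in> bot then d else d + i)" for i
  define w where "w i = (if i \<in> {1..n} then f i else 0)" for i
  have "w \<in> words n"
    unfolding words_iff w_def f_def using d by auto
  moreover have "w i < w (Suc i)" if "i \<in> {1..<n}" "up i" for i
  proof -
    have "i \<noteq> d" using d that by blast
    moreover have "Suc i \<notin> bot" using that unfolding bot_def by simp
    ultimately show ?thesis using that d unfolding w_def f_def by auto
  qed
  ultimately have wS: "w \<in> run_words n up" unfolding run_words_def by blast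
  have "Suc d \<in> bot" using d dn unfolding bot_def by simp
  then have "w d = w (Suc d)" using d dn unfolding w_def f_def by simp
  then have wN: "w \<notin> aligned_words n up"
    using d dn unfolding aligned_words_def by force

  have "content n w d = card bot"
  proof -
    have 1: "i = 1" if "i \<in> bot" "i \<le> d" for i
      using that before[of "i - 1"] unfolding bot_def by force
    \<comment> \<open>Position \<open>d\<close> stands in for the bottom 1 of the first run, so this
      class has one position per run.\<close>
    have "{i\<in>{1..n}. f i = d} = insert d (bot - {1})"
    proof
      show "{i\<in>{1..n}. f i = d} \<subseteq> insert d (bot - {1})"
        using d unfolding f_def by (auto split: if_splits)
      show "insert d (bot - {1}) \<subseteq> {i\<in>{1..n}. f i = d}"
        using d dn 1 unfolding f_def by (auto simp: bot_def)
    qed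
    moreover have "d \<notin> bot - {1}" using 1 by blast
    moreover have "1 \<in> bot" using e unfolding bot_def by simp
    ultimately have "card {i\<in>{1..n}. f i = d} = card bot"
      using fin_bot card_insert_disjoint[of "bot - {1}" d] card_Suc_Diff1[OF fin_bot] by simp
    moreover have "content n w = content n f"
      unfolding w_def by (rule content_cut)
    ultimately show ?thesis unfolding content_def by metis
  qed
  then have cont1: "(content n w \<circ> transpose 1 d) 1 = card bot" by simp

  \<comment> \<open>The letter 1 fits only at run bottoms, and there are as many letters 1 as runs,
    so it fills all of them. Every descent then drops from a larger letter to 1.\<close>
  have "?S (content n w \<circ> transpose 1 d) \<subseteq> ?N (content n w \<circ> transpose 1 d)"
  proof
    fix v assume v: "v \<in> ?S (content n w \<circ> transpose 1 d)"
    then have vw: "v \<in> words n" and inc: "\<And>i. i \<in> {1..<n} \<Longrightarrow> up i \<Longrightarrow> v i < v (Suc i)"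
      unfolding run_words_def by auto
    have sub: "{i\<in>{1..n}. v i = 1} \<subseteq> bot"
    proof
      fix i assume i: "i \<in> {i\<in>{1..n}. v i = 1}"
      have "\<not> up (i - 1)" if "i \<noteq> 1"
      proof
        assume "up (i - 1)"
        moreover have pred: "i - 1 \<in> {1..<n}" "Suc (i - 1) = i" using i that by auto
        ultimately have "v (i - 1) < 1" using inc[of "i - 1"] i by simp
        then show False using words_pos[OF vw, of "i - 1"] pred by auto
      qed
      then show "i \<in> bot" using i unfolding bot_def by blast
    qed
    have "content n v 1 = card bot" using v cont1 by simp
    then have "card {i\<in>{1..n}. v i = 1} = card bot" unfolding content_def .
    then have bot1: "{i\<in>{1..n}. v i = 1} = bot" by (rule card_subset_eq[OF fin_bot sub])
    have "v (Suc i) < v i" if i: "i \<in> {1..<n}" "\<not> up i" for i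
    proof -
      have "Suc i \<in> bot" using i unfolding bot_def by simp
      then have "v (Suc i) = 1" using bot1 by blast
      moreover have "i \<notin> bot" using bot_up i by blast
      then have "v i \<noteq> 1" using bot1 i by auto
      moreover have "0 < v i" using words_pos[OF vw, of i] i by simp
      ultimately show ?thesis by simp
    qed
    then show "v \<in> ?N (content n w \<circ> transpose 1 d)"
      using v vw inc unfolding aligned_words_def by auto
  qed
  then have "card (?S (content n w \<circ> transpose 1 d)) \<le> card (?N (content n w \<circ> transpose 1 d))"
    by (intro card_mono finite_subset[OF NS finS])
  moreover have "card (?S (content n w \<circ> transpose 1 d)) = card (?S (content n w))"
    by (rule card_run_words_transpose[OF d(1)])
  moreover have "transpose 1 d permutes {1..}"
    using d by (intro permutes_swap_id) auto
  then have "card (?N (content n w \<circ> transpose 1 d)) = card (?N (content n w))"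
    using sym unfolding cqf_symmetric_def up_def cqf_coeff_path_top[OF sigma, symmetric] by blast
  moreover have "card (?N (content n w)) < card (?S (content n w))"
    by (rule psubset_card_mono[OF finS]) (use NS wS wN in blast)
  ultimately show False by simp
qed

lemma increasing_imp_identity:
  assumes sigma: "sigma permutes {1..n}"
    and up: "\<And>i. i \<in> {1..<n} \<Longrightarrow> sigma i < sigma (Suc i)" and i: "i \<in> {1..n}"
  shows "sigma i = i"
proof -
  \<comment> \<open>Labels grow by at least one per step; the bounds 1 and \<open>n\<close> at the
    two ends leave no slack.\<close>
  have gap: "sigma a + (b - a) \<le> sigma b" if "1 \<le> a" "a \<le> b" "b \<le> n" for a b
    using that(2,3)
  proof (induction b rule: dec_induct)
    case (step b)
    then show ?case using up[of b] that(1) by simp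
  qed simp
  have "1 \<le> sigma 1" "sigma n \<le> n"
    using permutes_in_image[OF sigma, of 1] permutes_in_image[OF sigma, of n] i by auto
  then show ?thesis using gap[of 1 i] gap[of i n] i by simp
qed

subsection \<open>Reversing the path\<close>

definition rev_perm :: "nat \<Rightarrow> nat \<Rightarrow> nat" where
  "rev_perm n i = (if i \<in> {1..n} then n + 1 - i else i)"

lemma rev_perm_permutes: "rev_perm n permutes {1..n}"
proof (rule bij_imp_permutes)
  show "bij_betw (rev_perm n) {1..n} {1..n}"
    by (rule bij_betw_byWitness[where f' = "rev_perm n"]) (auto simp: rev_perm_def)
qed (auto simp: rev_perm_def)

text \<open>Reading from the other end keeps the graph but reverses the step directions, so the
  first step may be assumed to go up.\<close>

lemma path_edges_rev: "path_edges n (sigma \<circ> rev_perm n) = path_edges n sigma"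
proof -
  have rev: "rev_perm n i = Suc (n - i)" "rev_perm n (Suc i) = n - i" if "i \<in> {1..<n}" for i
    using that unfolding rev_perm_def by auto
  have "path_edges n (sigma \<circ> rev_perm n) a b \<longleftrightarrow> path_edges n sigma a b" for a b
  proof
    assume "path_edges n (sigma \<circ> rev_perm n) a b"
    then obtain i where i: "i \<in> {1..<n}" "(a = sigma (Suc (n - i)) \<and> b = sigma (n - i))
        \<or> (a = sigma (n - i) \<and> b = sigma (Suc (n - i)))"
      unfolding path_edges_def using rev by auto
    moreover have "n - i \<in> {1..<n}" using i by auto
    ultimately show "path_edges n sigma a b" unfolding path_edges_def by blast
  next
    assume "path_edges n sigma a b"
    then obtain i where i: "i \<in> {1..<n}"
      "(a = sigma i \<and> b = sigma (Suc i)) \<or> (a = sigma (Suc i) \<and> b = sigma i)"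
      unfolding path_edges_def by blast
    have "n - i \<in> {1..<n}" "n - (n - i) = i" using i by auto
    then show "path_edges n (sigma \<circ> rev_perm n) a b"
      unfolding path_edges_def using i(2) rev[of "n - i"] by (intro bexI[of _ "n - i"]) auto
  qed
  then show ?thesis by blast
qed

lemma natural_labeling_rev:
  assumes "natural_labeling n (sigma \<circ> rev_perm n)"
  shows "natural_labeling n sigma"
proof -
  have *: "sigma i = (sigma \<circ> rev_perm n) (n + 1 - i)" "n + 1 - i \<in> {1..n}" "n + 1 - (n + 1 - i) = i"
    if "i \<in> {1..n}" for i
    using that unfolding rev_perm_def by auto
  show ?thesis
    using assms unfolding natural_labeling_def by (metis *)
qed

section \<open>Assembling the two directions\<close>

lemma symmetric_start_up_imp_natural:
  assumes sigma: "sigma permutes {1..n}" and sym: "cqf_symmetric n (path_edges n sigma)"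
    and n: "2 \<le> n" and start: "sigma 1 < sigma (Suc 1)"
  shows "natural_labeling n sigma"
proof -
  define up where "up i \<longleftrightarrow> sigma i < sigma (Suc i)" for i
  have up: "up = (\<lambda>i. sigma i < sigma (Suc i))" unfolding up_def ..
  have up1: "up 1" using start unfolding up_def .
  have eq: "card (minima n up) = card (maxima n up)"
    using symmetric_imp_card_minima_eq_maxima[OF sigma sym] unfolding up .
  have last: "up (n - 1)"
  proof (rule ccontr)
    assume "\<not> up (n - 1)"
    then have "card (minima n up) + 0 = card (maxima n up) + 1"
      using card_minima_maxima[OF n, of up] up1 by (simp only: if_True if_False)
    then show False using eq by simp
  qed
  have isolated: "up (Suc j)" if "1 \<le> j" "Suc j < n" "\<not> up j" for j
    unfolding up_def by (rule symmetric_imp_no_double_descent[OF sigma sym start that[unfolded up_def]])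
  have "up i" if "i \<in> {1..<n}" for i
    unfolding up_def
    by (rule symmetric_isolated_descents_imp_increasing[OF sigma sym start last[unfolded up_def]
          isolated[unfolded up_def] that])
  then have "sigma i < sigma (Suc i)" if "i \<in> {1..<n}" for i
    using that unfolding up_def by blast
  then show ?thesis
    using increasing_imp_identity[OF sigma] unfolding natural_labeling_def by blast
qed

lemma symmetric_imp_natural:
  assumes n: "1 \<le> n" and sigma: "sigma permutes {1..n}" and sym: "cqf_symmetric n (path_edges n sigma)"
  shows "natural_labeling n sigma"
proof (cases "n = 1")
  case True
  then have "sigma 1 = 1" using permutes_in_image[OF sigma, of 1] by simp
  then show ?thesis using True unfolding natural_labeling_def by simp
next
  case False
  then have n2: "2 \<le> n" using n by simp
  show ?thesis
  proof (cases "sigma 1 < sigma (Suc 1)")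
    case True
    then show ?thesis using symmetric_start_up_imp_natural[OF sigma sym n2] by blast
  next
    case start: False
    let ?up = "\<lambda>i. sigma i < sigma (Suc i)"
    \<comment> \<open>Equally many minima and maxima make the last step go down like the first, so
      the reversed reading starts upwards.\<close>
    have "\<not> ?up (n - 1)"
      using card_minima_maxima[OF n2, of ?up] symmetric_imp_card_minima_eq_maxima[OF sigma sym] start
      by (simp split: if_splits)
    then have "sigma n < sigma (n - 1)"
      using permutes_Suc_neq[OF sigma, of "n - 1"] n2 by simp
    then have "(sigma \<circ> rev_perm n) 1 < (sigma \<circ> rev_perm n) (Suc 1)"
      using n2 unfolding rev_perm_def by (simp add: numeral_2_eq_2)
    then have "natural_labeling n (sigma \<circ> rev_perm n)"
      using sym n2 by (intro symmetric_start_up_imp_natural)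
        (auto simp only: path_edges_rev intro: permutes_compose[OF rev_perm_permutes sigma])
    then show ?thesis by (rule natural_labeling_rev)
  qed
qed

text \<open>The decreasing labeling is the increasing one read backwards, so both natural labelings
  give the same graph.\<close>

lemma natural_imp_symmetric:
  assumes sigma: "sigma permutes {1..n}" and nat: "natural_labeling n sigma"
  shows "cqf_symmetric n (path_edges n sigma)"
proof -
  have out: "sigma i = i" if "i \<notin> {1..n}" for i
    using permutes_not_in[OF sigma that] .
  consider "\<forall>i\<in>{1..n}. sigma i = i" | "\<forall>i\<in>{1..n}. sigma i = n + 1 - i"
    using nat unfolding natural_labeling_def by blast
  then have "path_edges n sigma = path_edges n id"
  proof cases
    case 1
    then have "sigma = id" using out by (metis eq_id_iff)
    then show ?thesis by simp
  next
    case 2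
    then have "sigma i = (id \<circ> rev_perm n) i" for i
      unfolding rev_perm_def using out[of i] by simp
    then have "sigma = id \<circ> rev_perm n" by (rule ext)
    then show ?thesis by (simp only: path_edges_rev)
  qed
  then show ?thesis by (simp only: cqf_symmetric_identity)
qed

theorem theorem1p1:
  fixes n :: nat and sigma :: "nat \<Rightarrow> nat"
  assumes "1 \<le> n" and "sigma permutes {1..n}"
  shows "cqf_symmetric n (path_edges n sigma) \<longleftrightarrow> natural_labeling n sigma"
  using symmetric_imp_natural[OF assms] natural_imp_symmetric[OF assms(2)] by blast

end
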